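(* Let $(K, \Lambda, Q, \tilde\Lambda_+, R_+, p, q, r, s)$ be a chopped and sliced cone such that $q$ has full rank, i.e. the linear map $q : K_{\mathbf{R}} \to Q_{\mathbf{R}}$ is surjective. Let $\lambda \in \Lambda$. Then the sequence of measures $\mu_\lambda^{(n)}$ ($n = 1, 2, \ldots$) on $Q_{\mathbf{R}}$ converges weakly to $\tilde\mu_\lambda$ for $n \to \infty$. Moreover, the limit measure $\tilde\mu_\lambda$ is absolutely continuous with respect to Lebesgue measure on $Q_{\mathbf{R}}$.
   Context: Chopped and sliced cones. Let $K$, $\Lambda$, $Q$ be free Abelian groups of finite rank, and let $\tilde\Lambda_+$, $R_+$ be free Abelian monoids of finite rank (i.e. isomorphic to $\mathbf{Z}_{\geq 0}^m$ for some $m$). Let $\tilde\Lambda$ and $R$ be the free Abelian groups generated by a basis of $\tilde\Lambda_+$ and $R_+$ respectively. On $\tilde\Lambda$ put the partial order $x \leq y$ iff $y - x \in \tilde\Lambda_+$, and similarly on $R$ (using $R_+$); these are extended to the real vector spaces $\tilde\Lambda_{\mathbf{R}}$, $R_{\mathbf{R}}$ as the componentwise orders with respect to the given bases. Here $K_{\mathbf{R}} = K \otimes_{\mathbf{Z}} \mathbf{R}$, and similarly for the other groups. Let $p : K \to \tilde\Lambda$, $q : K \to Q$, $r : K \to R$, $s : \Lambda \to \tilde\Lambda$ be group homomorphisms; their $\mathbf{R}$-linear extensions are denoted by the same symbols. The 9-tuple $(K, \Lambda, Q, \tilde\Lambda_+, R_+, p, q, r, s)$ is called a chopped and sliced cone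 if for every $\lambda \in \Lambda$ the set $$C^\lambda = \{ x \in K_{\mathbf{R}} : r(x) \geq 0,\ p(x) \leq s(\lambda) \}$$ is bounded. One writes $C = \{x \in K_{\mathbf{R}} : r(x) \geq 0\}$, and for $\lambda \in \Lambda$, $\beta \in Q$, $C^\lambda_\beta = \{ x \in C^\lambda : q(x) = \beta \}$. Measures. All real vector spaces carry their natural topology and Borel $\sigma$-algebra. $\delta_A$ denotes the counting measure of a set $A$, $\delta_\beta = \delta_{\{\beta\}}$ the Dirac measure, and $\phi_*$ the push-forward of measures under $\phi$. For $\lambda \in \Lambda$ put $$\mu_\lambda = \sum_{\beta \in Q} |C^\lambda_\beta \cap K| \cdot \delta_\beta = q_* \delta_{C^\lambda \cap K},$$ a measure on $Q_{\mathbf{R}}$, and for integers $n \geq 1$ $$\mu_\lambda^{(n)} = \frac{1}{n^{\mathrm{rk}(K)}} \bigl( \tfrac{1}{n} \mathrm{id}_{Q_{\mathbf{R}}} \bigr)_* \mu_{n\lambda}.$$ Let $\lambda_{K_{\mathbf{R}}}$ be Lebesgue measure on $K_{\mathbf{R}}$ normalized such that $K$ has covolume $1$; for measurable $M \subset K_{\mathbf{R}}$ let $\lambda_M$ be the measure with density $1_M$ (the characteristic function of $M$) with respect to $\lambda_{K_{\mathbf{R}}}$. Define $\tilde\mu_\lambda = q_* \lambda_{C^\lambda}$. Weak convergence means convergence of integrals against all bounded continuous real-valued functions. *)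

theory Defs
  imports "HOL-Analysis.Analysis"
begin

(* A free Abelian group K of finite rank is modelled inside its real vector space
   K \<otimes> R: the latter is a whole type, and K is the set of integer combinations of
   some finite real basis of that type. Rank 0 is included, which is why the class is
   real_vector / real_normed_vector and not euclidean_space (whose types have
   dimension at least 1). On a finite-dimensional space every norm induces the natural
   topology, and the space is automatically second countable; the latter is added as a
   sort constraint below only because it does not follow from real_normed_vector alone. *)

definition vector_basis :: "'a::real_vector set \<Rightarrow> bool" where
  "vector_basis B \<longleftrightarrow> finite B \<and> independent B \<and> span B = UNIV"

definition int_span :: "'a::real_vector set \<Rightarrow> 'a set" where
  "int_span B = {x. \<exists>c::'a \<Rightarrow> int. x = (\<Sum>b\<in>B. of_int (c b) *\<^sub>R b)}"

definition nat_span :: "'a::real_vector set \<Rightarrow> 'a set" where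
  "nat_span B = {x. \<exists>c::'a \<Rightarrow> nat. x = (\<Sum>b\<in>B. of_nat (c b) *\<^sub>R b)}"

definition free_ab_group :: "'a::real_vector set \<Rightarrow> bool" where
  "free_ab_group K \<longleftrightarrow> (\<exists>B. vector_basis B \<and> K = int_span B)"

definition free_ab_monoid :: "'a::real_vector set \<Rightarrow> bool" where
  "free_ab_monoid M \<longleftrightarrow> (\<exists>B. vector_basis B \<and> M = nat_span B)"

definition group_basis :: "'a::real_vector set \<Rightarrow> 'a set" where
  "group_basis K = (SOME B. vector_basis B \<and> K = int_span B)"

(* The basis of a free Abelian monoid is unique. *)
definition monoid_basis :: "'a::real_vector set \<Rightarrow> 'a set" where
  "monoid_basis M = (SOME B. vector_basis B \<and> M = nat_span B)"

definition group_rank :: "'a::real_vector set \<Rightarrow> nat" where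
  "group_rank K = card (group_basis K)"

definition monoid_group :: "'a::real_vector set \<Rightarrow> 'a set" where
  "monoid_group M = int_span (monoid_basis M)"

definition monoid_le :: "'a::real_vector set \<Rightarrow> 'a \<Rightarrow> 'a \<Rightarrow> bool" where
  "monoid_le M x y \<longleftrightarrow>
     (\<forall>b\<in>monoid_basis M. representation (monoid_basis M) x b \<le> representation (monoid_basis M) y b)"

(* A homomorphism is only constrained on K; its values elsewhere are irrelevant. *)
definition group_hom_on :: "'a::real_vector set \<Rightarrow> 'b::real_vector set \<Rightarrow> ('a \<Rightarrow> 'b) \<Rightarrow> bool" where
  "group_hom_on K H f \<longleftrightarrow> f \<in> K \<rightarrow> H \<and> (\<forall>x\<in>K. \<forall>y\<in>K. f (x + y) = f x + f y)"

definition real_ext :: "'a::real_vector set \<Rightarrow> ('a \<Rightarrow> 'b::real_vector) \<Rightarrow> 'a \<Rightarrow> 'b" where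
  "real_ext K f = construct (group_basis K) f"


definition chop_slice ::
    "'k::real_vector set \<Rightarrow> 't::real_vector set \<Rightarrow> 'r::real_vector set \<Rightarrow>
     ('k \<Rightarrow> 't) \<Rightarrow> ('k \<Rightarrow> 'r) \<Rightarrow> ('l \<Rightarrow> 't) \<Rightarrow> 'l \<Rightarrow> 'k set" where
  "chop_slice K Tp Rp p r s l =
     {x. monoid_le Rp 0 (real_ext K r x) \<and> monoid_le Tp (real_ext K p x) (s l)}"

(* Tp and monoid_group Tp are the monoid and the group written with a tilde over Lambda. *)
definition chopped_sliced_cone ::
    "'k::real_normed_vector set \<Rightarrow> 'l::real_vector set \<Rightarrow> 'q::real_vector set \<Rightarrow>
     't::real_vector set \<Rightarrow> 'r::real_vector set \<Rightarrow>
     ('k \<Rightarrow> 't) \<Rightarrow> ('k \<Rightarrow> 'q) \<Rightarrow> ('k \<Rightarrow> 'r) \<Rightarrow> ('l \<Rightarrow> 't) \<Rightarrow> bool" where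
  "chopped_sliced_cone K L Q Tp Rp p q r s \<longleftrightarrow>
     free_ab_group K \<and> free_ab_group L \<and> free_ab_group Q \<and>
     free_ab_monoid Tp \<and> free_ab_monoid Rp \<and>
     group_hom_on K (monoid_group Tp) p \<and> group_hom_on K Q q \<and>
     group_hom_on K (monoid_group Rp) r \<and> group_hom_on L (monoid_group Tp) s \<and>
     (\<forall>l\<in>L. bounded (chop_slice K Tp Rp p r s l))"


definition counting_measure :: "'a::topological_space set \<Rightarrow> 'a measure" where
  "counting_measure A = distr (count_space A) borel (\<lambda>x. x)"

(* Independent of the chosen Z-basis, since a change of basis has determinant 1 or -1. *)
definition lattice_lebesgue ::
    "'a::{real_normed_vector,second_countable_topology} set \<Rightarrow> 'a measure" where
  "lattice_lebesgue K =
     distr (Pi\<^sub>M (group_basis K) (\<lambda>_. lborel)) borel (\<lambda>c. \<Sum>b\<in>group_basis K. c b *\<^sub>R b)"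

definition mu ::
    "'k::real_normed_vector set \<Rightarrow> 't::real_vector set \<Rightarrow> 'r::real_vector set \<Rightarrow>
     ('k \<Rightarrow> 't) \<Rightarrow> ('k \<Rightarrow> 'q::real_normed_vector) \<Rightarrow> ('k \<Rightarrow> 'r) \<Rightarrow> ('l \<Rightarrow> 't) \<Rightarrow> 'l \<Rightarrow> 'q measure" where
  "mu K Tp Rp p q r s l =
     distr (counting_measure (chop_slice K Tp Rp p r s l \<inter> K)) borel (real_ext K q)"

definition mu_scaled ::
    "'k::real_normed_vector set \<Rightarrow> 't::real_vector set \<Rightarrow> 'r::real_vector set \<Rightarrow>
     ('k \<Rightarrow> 't) \<Rightarrow> ('k \<Rightarrow> 'q::real_normed_vector) \<Rightarrow> ('k \<Rightarrow> 'r) \<Rightarrow> ('l::real_vector \<Rightarrow> 't) \<Rightarrow> 'l \<Rightarrow>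
     nat \<Rightarrow> 'q measure" where
  "mu_scaled K Tp Rp p q r s l n =
     scale_measure (ennreal (1 / real n ^ group_rank K))
       (distr (mu K Tp Rp p q r s (real n *\<^sub>R l)) borel (\<lambda>x. (1 / real n) *\<^sub>R x))"

definition mu_limit ::
    "'k::{real_normed_vector,second_countable_topology} set \<Rightarrow>
     't::real_vector set \<Rightarrow> 'r::real_vector set \<Rightarrow>
     ('k \<Rightarrow> 't) \<Rightarrow> ('k \<Rightarrow> 'q::real_normed_vector) \<Rightarrow> ('k \<Rightarrow> 'r) \<Rightarrow> ('l \<Rightarrow> 't) \<Rightarrow> 'l \<Rightarrow> 'q measure" where
  "mu_limit K Tp Rp p q r s l =
     distr (density (lattice_lebesgue K) (indicator (chop_slice K Tp Rp p r s l)))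
       borel (real_ext K q)"

definition converges_weakly :: "(nat \<Rightarrow> 'a::topological_space measure) \<Rightarrow> 'a measure \<Rightarrow> bool" where
  "converges_weakly M N \<longleftrightarrow>
     (\<forall>f::'a \<Rightarrow> real. continuous_on UNIV f \<and> bounded (range f) \<longrightarrow>
        (\<lambda>n. integral\<^sup>L (M n) f) \<longlonglongrightarrow> integral\<^sup>L N f)"


lemma group_basis:
  assumes "free_ab_group K"
  shows "vector_basis (group_basis K)" "int_span (group_basis K) = K"
  using someI_ex[OF assms[unfolded free_ab_group_def]] unfolding group_basis_def by auto

lemma monoid_basis:
  assumes "free_ab_monoid M"
  shows "vector_basis (monoid_basis M)" "nat_span (monoid_basis M) = M"
  using someI_ex[OF assms[unfolded free_ab_monoid_def]] unfolding monoid_basis_def by auto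

lemma representation_lincomb:
  assumes "vector_basis B" "b \<in> B"
  shows "representation B (\<Sum>b\<in>B. c b *\<^sub>R b) b = c b"
proof -
  have B: "independent B" "finite B" "span B = UNIV"
    using assms by (auto simp: vector_basis_def)
  have "representation B (\<Sum>x\<in>B. c x *\<^sub>R x) b = (\<Sum>x\<in>B. representation B (c x *\<^sub>R x) b)"
    using B by (subst real_vector.representation_sum) auto
  also have "\<dots> = (\<Sum>x\<in>B. if x = b then c x else 0)"
    using B by (intro sum.cong)
      (auto simp: real_vector.representation_scale real_vector.representation_basis)
  finally show ?thesis using B assms by simp
qed

lemma linear_real_ext: "free_ab_group K \<Longrightarrow> linear (real_ext K f)"
  using group_basis(1)[of K] unfolding real_ext_def vector_basis_def
  by (auto intro: linear_construct)

lemma real_ext_eq: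
  assumes K: "free_ab_group K" and f: "group_hom_on K H f" and x: "x \<in> K"
  shows "real_ext K f x = f x"
proof -
  define B where "B = group_basis K"
  have B: "finite B" "independent B" "K = int_span B"
    using group_basis[OF K] by (auto simp: B_def vector_basis_def)
  have add: "f (x + y) = f x + f y" if "x \<in> K" "y \<in> K" for x y
    using f that by (auto simp: group_hom_on_def)
  have memI: "(\<Sum>b\<in>B. of_int (c b) *\<^sub>R b) \<in> K" for c :: "'a \<Rightarrow> int"
    using B by (auto simp: int_span_def)
  have zeroK: "0 \<in> K" using memI[of "\<lambda>_. 0"] by simp
  have f0: "f 0 = 0" using add[OF zeroK zeroK] by simp
  have scaleB: "of_int k *\<^sub>R b \<in> K" if "b \<in> B" for k b
  proof -
    have "(\<Sum>x\<in>B. of_int (if x = b then k else 0) *\<^sub>R x) = of_int k *\<^sub>R b"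
      using B that by (simp add: if_distrib[of of_int] if_distrib[of "\<lambda>t. t *\<^sub>R _"] cong: if_cong)
    then show ?thesis using memI[of "\<lambda>x. if x = b then k else 0"] by simp
  qed
  have fs: "f (of_int k *\<^sub>R b) = of_int k *\<^sub>R f b" if b: "b \<in> B" for k b
  proof (induction k rule: int_induct[where k = 0])
    case base then show ?case by (simp add: f0)
  next
    case (step1 i)
    have "f (of_int i *\<^sub>R b + of_int 1 *\<^sub>R b) = f (of_int i *\<^sub>R b) + f (of_int 1 *\<^sub>R b)"
      using add scaleB[OF b] by blast
    then show ?case using step1 by (simp add: scaleR_add_left)
  next
    case (step2 i)
    have "f (of_int (i - 1) *\<^sub>R b + of_int 1 *\<^sub>R b) = f (of_int (i - 1) *\<^sub>R b) + f (of_int 1 *\<^sub>R b)"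
      using add scaleB[OF b] by blast
    then show ?case using step2 by (simp add: scaleR_left_diff_distrib algebra_simps)
  qed
  obtain c :: "'a \<Rightarrow> int" where c: "x = (\<Sum>b\<in>B. of_int (c b) *\<^sub>R b)"
    using x B by (auto simp: int_span_def)
  have "S \<subseteq> B \<Longrightarrow> (\<Sum>b\<in>S. of_int (c b) *\<^sub>R b) \<in> K \<and>
          f (\<Sum>b\<in>S. of_int (c b) *\<^sub>R b) = (\<Sum>b\<in>S. of_int (c b) *\<^sub>R f b)" if "finite S" for S
    using that
  proof (induction S rule: finite_induct)
    case empty then show ?case by (simp add: zeroK f0)
  next
    case (insert b S)
    let ?g = "\<lambda>x. if x \<in> insert b S then c x else 0"
    have "(\<Sum>x\<in>insert b S. of_int (c x) *\<^sub>R x) = (\<Sum>x\<in>B. of_int (?g x) *\<^sub>R x)"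
      using insert B by (intro sum.mono_neutral_cong_left) auto
    then have "(\<Sum>x\<in>insert b S. of_int (c x) *\<^sub>R x) \<in> K" using memI[of ?g] by simp
    then show ?case using insert add scaleB fs by simp
  qed
  then have "f x = (\<Sum>b\<in>B. of_int (c b) *\<^sub>R f b)" using B c by blast
  moreover have "real_ext K f x = (\<Sum>b\<in>B. of_int (c b) *\<^sub>R f b)"
  proof -
    have lin: "linear (real_ext K f)" by (rule linear_real_ext[OF K])
    have basis: "real_ext K f b = f b" if "b \<in> B" for b
      using B(2) that by (simp add: real_ext_def B_def construct_basis)
    have "real_ext K f x = (\<Sum>b\<in>B. real_ext K f (of_int (c b) *\<^sub>R b))"
      unfolding c by (rule linear_sum[OF lin])
    also have "\<dots> = (\<Sum>b\<in>B. of_int (c b) *\<^sub>R f b)"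
      by (rule sum.cong[OF refl]) (simp only: linear_scale[OF lin] basis)
    finally show ?thesis .
  qed
  ultimately show ?thesis by simp
qed

lemma monoid_le_iff:
  assumes M: "free_ab_monoid M" and x: "x \<in> monoid_group M" and y: "y \<in> monoid_group M"
  shows "monoid_le M x y \<longleftrightarrow> y - x \<in> M"
proof -
  define B where "B = monoid_basis M"
  have B: "vector_basis B" "M = nat_span B" using monoid_basis[OF M] by (auto simp: B_def)
  obtain c d :: "'a \<Rightarrow> int" where c: "x = (\<Sum>b\<in>B. of_int (c b) *\<^sub>R b)"
    and d: "y = (\<Sum>b\<in>B. of_int (d b) *\<^sub>R b)"
    using x y by (auto simp: monoid_group_def int_span_def B_def)
  have le: "monoid_le M x y \<longleftrightarrow> (\<forall>b\<in>B. c b \<le> d b)"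
    unfolding monoid_le_def B_def[symmetric] c d
    by (simp add: representation_lincomb[OF B(1)])
  have diff: "y - x = (\<Sum>b\<in>B. of_int (d b - c b) *\<^sub>R b)"
    unfolding c d by (simp add: sum_subtractf scaleR_left_diff_distrib)
  show ?thesis
  proof
    assume "monoid_le M x y"
    then have "y - x = (\<Sum>b\<in>B. of_nat (nat (d b - c b)) *\<^sub>R b)"
      unfolding le diff by (intro sum.cong) auto
    then show "y - x \<in> M" unfolding B(2) nat_span_def by (intro CollectI exI)
  next
    assume "y - x \<in> M"
    then obtain k :: "'a \<Rightarrow> nat" where k: "y - x = (\<Sum>b\<in>B. of_nat (k b) *\<^sub>R b)"
      unfolding B(2) nat_span_def by auto
    have "of_int (d b - c b) = (of_nat (k b) :: real)" if "b \<in> B" for b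
      using representation_lincomb[OF B(1) that, of "\<lambda>b. of_int (d b - c b)"]
        representation_lincomb[OF B(1) that, of "\<lambda>b. of_nat (k b)"] k diff by simp
    then show "monoid_le M x y" unfolding le
      by (smt (verit) of_int_of_nat_eq of_int_eq_iff of_nat_0_le_iff)
  qed
qed

end

theory Submission
  imports Defs
begin

text \<open>The integral of \<open>f\<close> against \<open>\<mu>\<^sub>\<lambda>\<close>, rescaled by \<open>n\<close>, is the Riemann sum of
  \<open>g = 1\<^sub>C (f \<circ> q)\<close> over the lattice \<open>(1/n) K\<close>, where \<open>C\<close> is the polytope \<open>C\<^sup>\<lambda>\<close>. Rounding down to
  \<open>(1/n) K\<close> turns this sum into the integral of \<open>g\<close> composed with the rounding map, and dominated
  convergence applies because \<open>g\<close> is continuous off the facet hyperplanes of \<open>C\<close>, which are null.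
  Both this and the absolute continuity rest on one fact: the preimage of a null set under a
  surjective linear map is null. It follows from Fubini and translation invariance, without any
  determinant.\<close>

lemma vector_basis_sum_representation:
  assumes "vector_basis B"
  shows "(\<Sum>b\<in>B. representation B x b *\<^sub>R b) = x"
  using assms unfolding vector_basis_def
  by (intro real_vector.sum_representation_eq) auto

lemma vector_basis_representation_add:
  assumes "vector_basis B"
  shows "representation B (x + y) b = representation B x b + representation B y b"
  using assms by (simp add: vector_basis_def real_vector.representation_add)

lemma vector_basis_representation_scale:
  assumes "vector_basis B"
  shows "representation B (c *\<^sub>R x) b = c * representation B x b"
  using assms by (simp add: vector_basis_def real_vector.representation_scale)

lemma linear_representation:
  assumes "vector_basis B"
  shows "linear (\<lambda>x. representation B x b)"
  using assms
  by (intro linearI) (auto simp: vector_basis_representation_add vector_basis_representation_scale)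

text \<open>The class \<^class>\<open>euclidean_space\<close> is not available here, so the continuity of linear maps
  on a finite-dimensional space is derived from the compactness of the unit cube of coordinates.\<close>

lemma vector_basis_representation_bound:
  fixes B :: "'a::real_normed_vector set"
  assumes B: "vector_basis B"
  shows "\<exists>C\<ge>0. \<forall>x. \<forall>b\<in>B. \<bar>representation B x b\<bar> \<le> C * norm x"
proof (cases "B = {}")
  case True
  then show ?thesis by auto
next
  case False
  have fin: "finite B" using B by (simp add: vector_basis_def)
  define T where "T c = (\<Sum>b\<in>B. c b *\<^sub>R b)" for c :: "'a \<Rightarrow> real"
  define Cube where "Cube = Pi\<^sub>E (UNIV :: 'a set) (\<lambda>b. if b \<in> B then {-1..1::real} else {0})"
  define S where "S = Cube \<inter> (\<Union>b\<in>B. {c. \<bar>c b\<bar> = 1})"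
  have "compactin (product_topology (\<lambda>i::'a. euclidean::real topology) UNIV) Cube"
    unfolding Cube_def by (subst compactin_PiE) auto
  then have "compact Cube"
    by (simp add: euclidean_product_topology)
  moreover have "closed (\<Union>b\<in>B. {c::'a \<Rightarrow> real. \<bar>c b\<bar> = 1})"
    using fin by (intro closed_UN ballI closed_Collect_eq continuous_intros) auto
  ultimately have "compact S"
    unfolding S_def by (rule compact_Int_closed)
  moreover have "S \<noteq> {}"
  proof -
    obtain b0 where "b0 \<in> B" using False by auto
    then have "(\<lambda>b. if b \<in> B then 1 else 0) \<in> S"
      by (auto simp: S_def Cube_def)
    then show ?thesis by auto
  qed
  moreover have "continuous_on S (\<lambda>c. norm (T c))"
    unfolding T_def
    by (intro continuous_intros continuous_on_subset[OF continuous_on_product_coordinates]) auto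
  ultimately obtain c0 where c0: "c0 \<in> S" "\<And>c. c \<in> S \<Longrightarrow> norm (T c0) \<le> norm (T c)"
    using continuous_attains_inf[of S "\<lambda>c. norm (T c)"] by blast
  define m where "m = norm (T c0)"
  have "m > 0"
  proof (rule ccontr)
    assume "\<not> m > 0"
    then have "T c0 = 0" by (simp add: m_def)
    then have "c0 b = 0" if "b \<in> B" for b
      using representation_lincomb[OF B that, of c0] by (simp add: T_def real_vector.representation_zero)
    moreover obtain b where "b \<in> B" "\<bar>c0 b\<bar> = 1" using c0(1) by (auto simp: S_def)
    ultimately show False by force
  qed
  have bound: "\<bar>representation B x b\<bar> \<le> (1 / m) * norm x" if b: "b \<in> B" for x b
  proof -
    define c where "c = representation B x"
    define M where "M = Max ((\<lambda>b. \<bar>c b\<bar>) ` B)"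
    have le: "\<bar>c b\<bar> \<le> M" if "b \<in> B" for b
      using fin that by (auto simp: M_def)
    show ?thesis
    proof (cases "M > 0")
      case False
      then have "\<bar>c b\<bar> \<le> 0" using le[OF b] by linarith
      moreover have "(1 / m) * norm x \<ge> 0" using \<open>m > 0\<close> by simp
      ultimately show ?thesis unfolding c_def by linarith
    next
      case True
      have "M \<in> (\<lambda>b. \<bar>c b\<bar>) ` B" unfolding M_def
        using fin b by (intro Max_in) auto
      then obtain b1 where b1: "b1 \<in> B" "M = \<bar>c b1\<bar>" by auto
      define c' where "c' b = (if b \<in> B then c b / M else 0)" for b
      have "c' \<in> S"
        using le True b1 unfolding S_def Cube_def c'_def
        by (auto simp: field_simps abs_le_iff intro!: bexI[of _ b1])
           (smt (verit) le)+
      then have "m \<le> norm (T c')" unfolding m_def by (rule c0(2))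
      also have "T c' = (1 / M) *\<^sub>R (\<Sum>b\<in>B. c b *\<^sub>R b)"
        unfolding T_def scaleR_sum_right by (intro sum.cong) (auto simp: c'_def)
      also have "\<dots> = (1 / M) *\<^sub>R x"
        unfolding c_def by (simp add: vector_basis_sum_representation[OF B])
      also have "norm \<dots> = norm x / M" using True by simp
      finally have "M \<le> (1 / m) * norm x"
        using True \<open>m > 0\<close> by (simp add: field_simps)
      then show ?thesis using le[OF b] unfolding c_def by linarith
    qed
  qed
  show ?thesis
    using bound \<open>m > 0\<close> by (intro exI[of _ "1 / m"]) auto
qed

lemma vector_basis_bounded_linear:
  fixes B :: "'a::real_normed_vector set" and f :: "'a \<Rightarrow> 'b::real_normed_vector"
  assumes B: "vector_basis B" and f: "linear f"
  shows "bounded_linear f"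
proof -
  obtain C where C: "\<forall>x. \<forall>b\<in>B. \<bar>representation B x b\<bar> \<le> C * norm x"
    using vector_basis_representation_bound[OF B] by blast
  have "norm (f x) \<le> norm x * (\<Sum>b\<in>B. C * norm (f b))" for x
  proof -
    have "f x = (\<Sum>b\<in>B. representation B x b *\<^sub>R f b)"
      by (subst (1) vector_basis_sum_representation[OF B, of x, symmetric])
         (simp add: linear_sum[OF f] linear_scale[OF f])
    also have "norm \<dots> \<le> (\<Sum>b\<in>B. (C * norm x) * norm (f b))"
      by (rule sum_norm_le) (simp add: mult_right_mono C)
    also have "\<dots> = norm x * (\<Sum>b\<in>B. C * norm (f b))"
      by (simp add: sum_distrib_left mult_ac)
    finally show ?thesis .
  qed
  then show ?thesis
    using f by (intro bounded_linear_intro) (auto simp: linear_add linear_scale)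
qed

lemma continuous_on_linear_basis:
  fixes B :: "'a::real_normed_vector set" and f :: "'a \<Rightarrow> 'b::real_normed_vector"
  assumes "vector_basis B" "linear f"
  shows "continuous_on S f"
  using vector_basis_bounded_linear[OF assms] by (rule linear_continuous_on)

lemma (in product_sigma_finite) distr_PiM_componentwise:
  assumes I: "finite I"
    and g: "\<And>i. i \<in> I \<Longrightarrow> g i \<in> measurable (M i) (M i)"
    and inv: "\<And>i. i \<in> I \<Longrightarrow> distr (M i) (M i) (g i) = M i"
  shows "distr (Pi\<^sub>M I M) (Pi\<^sub>M I M) (\<lambda>c. \<lambda>i\<in>I. g i (c i)) = Pi\<^sub>M I M"
proof (rule PiM_eqI[OF I])
  show "sets (distr (Pi\<^sub>M I M) (Pi\<^sub>M I M) (\<lambda>c. \<lambda>i\<in>I. g i (c i))) = Pi\<^sub>M I M" by simp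
next
  fix A assume A: "\<And>i. i \<in> I \<Longrightarrow> A i \<in> sets (M i)"
  have meas: "(\<lambda>c. \<lambda>i\<in>I. g i (c i)) \<in> measurable (Pi\<^sub>M I M) (Pi\<^sub>M I M)"
    using g by (intro measurable_restrict measurable_compose[OF measurable_component_singleton]) auto
  have "emeasure (distr (Pi\<^sub>M I M) (Pi\<^sub>M I M) (\<lambda>c. \<lambda>i\<in>I. g i (c i))) (Pi\<^sub>E I A)
      = emeasure (Pi\<^sub>M I M) ((\<lambda>c. \<lambda>i\<in>I. g i (c i)) -` Pi\<^sub>E I A \<inter> space (Pi\<^sub>M I M))"
    using meas A I by (intro emeasure_distr) (auto intro!: sets_PiM_I_finite)
  also have "(\<lambda>c. \<lambda>i\<in>I. g i (c i)) -` Pi\<^sub>E I A \<inter> space (Pi\<^sub>M I M)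
      = Pi\<^sub>E I (\<lambda>i. g i -` A i \<inter> space (M i))"
    by (auto simp: space_PiM PiE_iff)
  also have "emeasure (Pi\<^sub>M I M) \<dots> = (\<Prod>i\<in>I. emeasure (M i) (g i -` A i \<inter> space (M i)))"
    using A g by (intro emeasure_PiM I) (auto intro!: measurable_sets)
  also have "\<dots> = (\<Prod>i\<in>I. emeasure (distr (M i) (M i) (g i)) (A i))"
    using A g by (intro prod.cong refl) (simp add: emeasure_distr)
  also have "\<dots> = (\<Prod>i\<in>I. emeasure (M i) (A i))"
    by (intro prod.cong refl) (simp add: inv)
  finally show "emeasure (distr (Pi\<^sub>M I M) (Pi\<^sub>M I M) (\<lambda>c. \<lambda>i\<in>I. g i (c i))) (Pi\<^sub>E I A)
      = (\<Prod>i\<in>I. emeasure (M i) (A i))" .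
qed

text \<open>For a section \<open>g\<close> of \<open>f\<close>, both Fubini orders of \<open>M \<Otimes> N\<close> on
  \<open>{(x, y). f x + y \<in> A}\<close> are computed by translation invariance.\<close>

lemma null_sets_vimage_translation_invariant:
  fixes M :: "'a::{real_normed_vector, second_countable_topology} measure"
    and N :: "'b::{real_normed_vector, second_countable_topology} measure"
  assumes M: "sigma_finite_measure M" "sets M = sets borel" "\<And>a. distr M borel ((+) a) = M"
    and N: "sigma_finite_measure N" "sets N = sets borel" "\<And>a. distr N borel ((+) a) = N"
      "emeasure N UNIV \<noteq> 0"
    and f: "f \<in> borel_measurable borel" and g: "g \<in> borel_measurable borel"
    and fg: "\<And>x y. f (x + g y) = f x + y"
    and A: "A \<in> null_sets N"
  shows "f -` A \<in> null_sets M"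
proof -
  interpret M: sigma_finite_measure M by (rule M)
  interpret N: sigma_finite_measure N by (rule N)
  interpret pair_sigma_finite M N ..
  have A': "A \<in> sets borel" using A N by auto
  have [measurable_cong]: "sets M = sets borel" "sets N = sets borel" by (fact M N)+
  have sp: "space M = UNIV" "space N = UNIV"
    using sets_eq_imp_space_eq[OF M(2)] sets_eq_imp_space_eq[OF N(2)] by auto
  note [measurable] = f g A'
  define E where "E = {z. f (fst z) + snd z \<in> A}"
  have "(\<lambda>z. f (fst z) + snd z) \<in> measurable (M \<Otimes>\<^sub>M N) borel"
    by measurable
  from measurable_sets[OF this A'] have E: "E \<in> sets (M \<Otimes>\<^sub>M N)"
    by (simp add: E_def vimage_def space_pair_measure sp)
  have shift: "emeasure N ((+) a -` A) = emeasure N A" for a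
  proof -
    have "emeasure (distr N borel ((+) a)) A = emeasure N ((+) a -` A \<inter> space N)"
      by (rule emeasure_distr) measurable
    then show ?thesis by (simp add: N(3) sp)
  qed
  have shiftM: "emeasure M ((+) a -` (f -` A)) = emeasure M (f -` A)" for a
  proof -
    have fA: "f -` A \<in> sets borel" using measurable_sets[OF f A'] by simp
    have "emeasure (distr M borel ((+) a)) (f -` A) = emeasure M ((+) a -` (f -` A) \<inter> space M)"
      by (rule emeasure_distr[OF _ fA]) measurable
    then show ?thesis by (simp add: M(3) sp)
  qed
  have "emeasure (M \<Otimes>\<^sub>M N) E = (\<integral>\<^sup>+x. emeasure N (Pair x -` E) \<partial>M)"
    by (rule N.emeasure_pair_measure_alt[OF E])
  also have "\<dots> = (\<integral>\<^sup>+x. 0 \<partial>M)"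
  proof (rule nn_integral_cong)
    fix x
    have "Pair x -` E = (+) (f x) -` A" by (auto simp: E_def)
    then show "emeasure N (Pair x -` E) = 0" using shift A by auto
  qed
  finally have 0: "emeasure (M \<Otimes>\<^sub>M N) E = 0" by simp
  have "emeasure (M \<Otimes>\<^sub>M N) E = (\<integral>\<^sup>+y. emeasure M ((\<lambda>x. (x, y)) -` E) \<partial>N)"
    by (rule emeasure_pair_measure_alt2[OF E])
  also have "\<dots> = (\<integral>\<^sup>+y. emeasure M (f -` A) \<partial>N)"
  proof (rule nn_integral_cong)
    fix y
    have "(\<lambda>x. (x, y)) -` E = (+) (g y) -` (f -` A)"
      using fg[of _ y] by (auto simp: E_def add.commute)
    then show "emeasure M ((\<lambda>x. (x, y)) -` E) = emeasure M (f -` A)" using shiftM by simp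
  qed
  also have "\<dots> = emeasure M (f -` A) * emeasure N UNIV" by (simp add: sp)
  finally have "emeasure M (f -` A) = 0" using 0 N(4) by simp
  moreover have "f -` A \<in> sets M" using measurable_sets[OF f A'] M(2) by simp
  ultimately show ?thesis by auto
qed

locale real_lattice =
  fixes K :: "'k::{real_normed_vector,second_countable_topology} set"
  assumes free: "free_ab_group K"
begin

abbreviation B where "B \<equiv> group_basis K"
abbreviation coord where "coord \<equiv> representation B"
definition comb where "comb c = (\<Sum>b\<in>B. c b *\<^sub>R b)"

lemma basis: "vector_basis B"
  using group_basis[OF free] by simp

lemma finite_basis [simp]: "finite B"
  using basis by (simp add: vector_basis_def)

lemma comb_coord [simp]: "comb (coord x) = x"
  unfolding comb_def by (rule vector_basis_sum_representation[OF basis])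

lemma coord_comb: "b \<in> B \<Longrightarrow> coord (comb c) b = c b"
  unfolding comb_def by (rule representation_lincomb[OF basis])

lemma comb_cong: "(\<And>b. b \<in> B \<Longrightarrow> c b = d b) \<Longrightarrow> comb c = comb d"
  unfolding comb_def by (auto intro: sum.cong)

lemma coord_eqI: "(\<And>b. b \<in> B \<Longrightarrow> coord x b = coord y b) \<Longrightarrow> x = y"
  using comb_cong[of "coord x" "coord y"] by simp

lemma coord_add: "coord (x + y) b = coord x b + coord y b"
  by (rule vector_basis_representation_add[OF basis])

lemma coord_scale: "coord (c *\<^sub>R x) b = c * coord x b"
  by (rule vector_basis_representation_scale[OF basis])

lemma continuous_on_linear: "linear (f :: 'k \<Rightarrow> 'b::real_normed_vector) \<Longrightarrow> continuous_on S f"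
  by (rule continuous_on_linear_basis[OF basis])

lemma borel_measurable_linear: "linear (f :: 'k \<Rightarrow> 'b::real_normed_vector) \<Longrightarrow> f \<in> borel_measurable borel"
  by (intro borel_measurable_continuous_onI continuous_on_linear)

lemma borel_measurable_coord [measurable]: "(\<lambda>x. coord x b) \<in> borel_measurable borel"
  by (intro borel_measurable_linear linear_representation basis)

abbreviation P where "P \<equiv> Pi\<^sub>M B (\<lambda>_. lborel :: real measure)"
abbreviation leb where "leb \<equiv> lattice_lebesgue K"

lemma measurable_comb [measurable]: "comb \<in> measurable P borel"
  unfolding comb_def by measurable

lemma lattice_lebesgue_eq: "leb = distr P borel comb"
  unfolding lattice_lebesgue_def comb_def ..

lemma sets_leb [simp, measurable_cong]: "sets leb = sets borel"
  by (simp add: lattice_lebesgue_eq)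

lemma space_leb [simp]: "space leb = UNIV"
  by (simp add: lattice_lebesgue_eq)

sublocale product_sigma_finite "\<lambda>_::'k. lborel :: real measure" ..

lemma measurable_coords: "(\<lambda>x. \<lambda>b\<in>B. coord x b) \<in> measurable borel P"
  by (intro measurable_restrict) measurable

lemma distr_leb_coords: "distr leb P (\<lambda>x. \<lambda>b\<in>B. coord x b) = P"
proof -
  have "distr leb P (\<lambda>x. \<lambda>b\<in>B. coord x b) = distr P P ((\<lambda>x. \<lambda>b\<in>B. coord x b) \<circ> comb)"
    unfolding lattice_lebesgue_eq by (rule distr_distr[OF measurable_coords measurable_comb])
  also have "\<dots> = distr P P (\<lambda>c. c)"
    by (rule distr_cong) (auto simp: space_PiM coord_comb fun_eq_iff PiE_def extensional_def)
  also have "\<dots> = P" by (rule distr_id)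
  finally show ?thesis .
qed

lemma emeasure_leb_box:
  assumes "\<And>b. b \<in> B \<Longrightarrow> X b \<in> sets borel"
  shows "emeasure leb {x. \<forall>b\<in>B. coord x b \<in> X b} = (\<Prod>b\<in>B. emeasure lborel (X b))"
proof -
  have "(\<Prod>b\<in>B. emeasure lborel (X b)) = emeasure (distr leb P (\<lambda>x. \<lambda>b\<in>B. coord x b)) (Pi\<^sub>E B X)"
    unfolding distr_leb_coords using assms by (intro emeasure_PiM[symmetric]) auto
  also have "\<dots> = emeasure leb ((\<lambda>x. \<lambda>b\<in>B. coord x b) -` Pi\<^sub>E B X \<inter> space leb)"
    using assms measurable_coords by (intro emeasure_distr) (auto intro!: sets_PiM_I_finite)
  also have "(\<lambda>x. \<lambda>b\<in>B. coord x b) -` Pi\<^sub>E B X \<inter> space leb = {x. \<forall>b\<in>B. coord x b \<in> X b}"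
    by (auto simp: PiE_iff)
  finally show ?thesis by simp
qed

lemma sigma_finite_leb: "sigma_finite_measure leb"
proof (rule sigma_finite_measure_distr)
  interpret finite_product_sigma_finite "\<lambda>_::'k. lborel :: real measure" B
    by standard simp
  show "sigma_finite_measure (distr leb P (\<lambda>x. \<lambda>b\<in>B. coord x b))"
    unfolding distr_leb_coords by (rule sigma_finite_measure_axioms)
  show "(\<lambda>x. \<lambda>b\<in>B. coord x b) \<in> measurable leb P"
    using measurable_coords by simp
qed

lemma leb_UNIV: "emeasure leb UNIV \<noteq> 0"
  using emeasure_leb_box[of "\<lambda>_. UNIV"] by (simp add: prod_zero_iff)

lemma leb_translation: "distr leb borel ((+) a) = leb"
proof -
  have "distr leb borel ((+) a) = distr P borel ((+) a \<circ> comb)"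
    unfolding lattice_lebesgue_eq by (rule distr_distr) measurable
  also have "\<dots> = distr P borel (comb \<circ> (\<lambda>c. \<lambda>b\<in>B. coord a b + c b))"
    by (intro distr_cong refl coord_eqI) (auto simp: coord_add coord_comb)
  also have "\<dots> = distr (distr P P (\<lambda>c. \<lambda>b\<in>B. coord a b + c b)) borel comb"
    by (rule distr_distr[symmetric]) measurable
  also have "distr P P (\<lambda>c. \<lambda>b\<in>B. coord a b + c b) = P"
  proof (rule distr_PiM_componentwise)
    show "distr lborel lborel ((+) (coord a b)) = (lborel :: real measure)" for b
      using lborel_distr_plus[of "coord a b"] by (simp cong: distr_cong)
  qed auto
  finally show ?thesis by (simp add: lattice_lebesgue_eq)
qed

lemma null_sets_vimage_linear:
  fixes f :: "'k \<Rightarrow> 'b::{real_normed_vector, second_countable_topology}"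
  assumes f: "linear f" and g: "continuous_on UNIV g" "\<And>y. f (g y) = y"
    and N: "sigma_finite_measure N" "sets N = sets borel" "\<And>a. distr N borel ((+) a) = N"
      "emeasure N UNIV \<noteq> 0"
    and A: "A \<in> null_sets N"
  shows "f -` A \<in> null_sets leb"
  using A
  by (intro null_sets_vimage_translation_invariant[where N = N and g = g]
        sigma_finite_leb sets_leb leb_translation N borel_measurable_linear f
        borel_measurable_continuous_onI g)
     (auto simp: linear_add[OF f] g)

lemma null_sets_hyperplane:
  fixes f :: "'k \<Rightarrow> real"
  assumes f: "linear f" and x: "f x \<noteq> 0"
  shows "{y. f y = h} \<in> null_sets leb"
proof -
  have "f -` {h} \<in> null_sets leb"
  proof (rule null_sets_vimage_linear[where N = lborel and g = "\<lambda>t. (t / f x) *\<^sub>R x"])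
    show "continuous_on UNIV (\<lambda>t. (t / f x) *\<^sub>R x)"
      using x by (intro continuous_intros) auto
    show "f ((t / f x) *\<^sub>R x) = t" for t
      using x by (simp add: linear_scale[OF f])
    show "distr lborel borel ((+) a) = (lborel :: real measure)" for a
      by (rule lborel_distr_plus)
    show "{h} \<in> null_sets lborel" by auto
  qed (auto simp: f sigma_finite_lborel)
  then show ?thesis by (simp add: vimage_def)
qed

end

lemma tendsto_floor_quotient:
  fixes c :: real
  shows "(\<lambda>n. of_int \<lfloor>real (Suc n) * c\<rfloor> / real (Suc n)) \<longlonglongrightarrow> c"
proof (rule real_tendsto_sandwich[where f = "\<lambda>n. c - 1 / real (Suc n)" and h = "\<lambda>n. c"])
  show "\<forall>\<^sub>F n in sequentially. c - 1 / real (Suc n) \<le> of_int \<lfloor>real (Suc n) * c\<rfloor> / real (Suc n)"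
  proof (rule always_eventually, rule allI)
    fix n
    have "real (Suc n) * c - 1 \<le> of_int \<lfloor>real (Suc n) * c\<rfloor>" by linarith
    then have "(real (Suc n) * c - 1) / real (Suc n) \<le> of_int \<lfloor>real (Suc n) * c\<rfloor> / real (Suc n)"
      by (rule divide_right_mono) simp
    then show "c - 1 / real (Suc n) \<le> of_int \<lfloor>real (Suc n) * c\<rfloor> / real (Suc n)"
      by (simp only: diff_divide_distrib) simp
  qed
  show "\<forall>\<^sub>F n in sequentially. of_int \<lfloor>real (Suc n) * c\<rfloor> / real (Suc n) \<le> c"
  proof (rule always_eventually, rule allI)
    fix n
    have "of_int \<lfloor>real (Suc n) * c\<rfloor> \<le> c * real (Suc n)" by (simp only: mult.commute[of c] of_int_floor_le)
    then show "of_int \<lfloor>real (Suc n) * c\<rfloor> / real (Suc n) \<le> c"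
      by (subst pos_divide_le_eq) simp_all
  qed
  show "(\<lambda>n. c - 1 / real (Suc n)) \<longlonglongrightarrow> c"
    using tendsto_diff[OF tendsto_const LIMSEQ_inverse_real_of_nat, of c] by (simp add: inverse_eq_divide)
qed simp

context real_lattice
begin

lemma mem_lattice_iff: "x \<in> K \<longleftrightarrow> (\<forall>b\<in>B. coord x b \<in> \<int>)"
proof
  assume "x \<in> K"
  then obtain c :: "'k \<Rightarrow> int" where "x = comb (\<lambda>b. of_int (c b))"
    using group_basis(2)[OF free] by (auto simp: int_span_def comb_def)
  then show "\<forall>b\<in>B. coord x b \<in> \<int>" by (simp add: coord_comb)
next
  assume "\<forall>b\<in>B. coord x b \<in> \<int>"
  then have "comb (coord x) = comb (\<lambda>b. of_int \<lfloor>coord x b\<rfloor>)"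
    by (intro comb_cong) (auto elim!: Ints_cases)
  then have "x = (\<Sum>b\<in>B. of_int \<lfloor>coord x b\<rfloor> *\<^sub>R b)"
    unfolding comb_coord by (simp add: comb_def)
  then have "x \<in> int_span B" unfolding int_span_def
    by (intro CollectI exI[of _ "\<lambda>b. \<lfloor>coord x b\<rfloor>"])
  then show "x \<in> K" using group_basis(2)[OF free] by simp
qed

lemma bounded_coord:
  assumes "bounded D"
  shows "\<exists>C. \<forall>x\<in>D. \<forall>b\<in>B. \<bar>coord x b\<bar> \<le> C"
proof -
  obtain R where R: "\<And>x. x \<in> D \<Longrightarrow> norm x \<le> R" "R > 0"
    using assms unfolding bounded_pos by auto
  obtain C where C: "C \<ge> 0" "\<forall>x. \<forall>b\<in>B. \<bar>coord x b\<bar> \<le> C * norm x"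
    using vector_basis_representation_bound[OF basis] by blast
  show ?thesis
  proof (intro exI[of _ "C * R"] ballI)
    fix x b assume "x \<in> D" "b \<in> B"
    then have "\<bar>coord x b\<bar> \<le> C * norm x" "C * norm x \<le> C * R"
      using C R(1) by (auto intro: mult_left_mono)
    then show "\<bar>coord x b\<bar> \<le> C * R" by linarith
  qed
qed

lemma finite_lattice_points:
  assumes "\<And>x b. x \<in> D \<Longrightarrow> b \<in> B \<Longrightarrow> \<bar>coord x b\<bar> \<le> C"
  shows "finite (K \<inter> D)"
proof (rule finite_subset)
  let ?X = "Pi\<^sub>E B (\<lambda>_. {- \<lceil>C\<rceil>..\<lceil>C\<rceil>})"
  show "finite ((\<lambda>c. comb (\<lambda>b. of_int (c b))) ` ?X)"
    by (intro finite_imageI finite_PiE) auto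
  show "K \<inter> D \<subseteq> (\<lambda>c. comb (\<lambda>b. of_int (c b))) ` ?X"
  proof
    fix x assume x: "x \<in> K \<inter> D"
    define c where "c = restrict (\<lambda>b. \<lfloor>coord x b\<rfloor>) B"
    have c: "of_int (c b) = coord x b" if "b \<in> B" for b
      using x that mem_lattice_iff by (auto simp: c_def elim!: Ints_cases)
    have "comb (\<lambda>b. of_int (c b)) = comb (coord x)" by (rule comb_cong) (rule c)
    then have "x = comb (\<lambda>b. of_int (c b))" by simp
    moreover have "c \<in> ?X"
    proof (rule PiE_I)
      fix b assume b: "b \<in> B"
      have "\<bar>coord x b\<bar> \<le> C" using assms x b by auto
      then have "\<bar>real_of_int (c b)\<bar> \<le> C" using c[OF b] by simp
      then show "c b \<in> {- \<lceil>C\<rceil>..\<lceil>C\<rceil>}" by (simp add: abs_le_iff) linarith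
    qed (simp add: c_def)
    ultimately show "x \<in> (\<lambda>c. comb (\<lambda>b. of_int (c b))) ` ?X" by blast
  qed
qed

definition lattice_floor where
  "lattice_floor n x = comb (\<lambda>b. of_int \<lfloor>real n * coord x b\<rfloor> / real n)"

lemma measurable_lattice_floor [measurable]: "lattice_floor n \<in> borel_measurable borel"
  unfolding lattice_floor_def comb_def by measurable

lemma tendsto_lattice_floor: "(\<lambda>n. lattice_floor (Suc n) x) \<longlonglongrightarrow> x"
proof -
  have "(\<lambda>n. lattice_floor (Suc n) x) \<longlonglongrightarrow> comb (coord x)"
    unfolding lattice_floor_def comb_def
    by (intro tendsto_sum tendsto_scaleR tendsto_const tendsto_floor_quotient)
  then show ?thesis by simp
qed

definition cell where
  "cell n z = {x. \<forall>b\<in>B. coord x b \<in> {coord z b / real n ..< (coord z b + 1) / real n}}"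

lemma mem_cell_iff:
  assumes n: "n > 0" and z: "z \<in> K"
  shows "x \<in> cell n z \<longleftrightarrow> lattice_floor n x = (1 / real n) *\<^sub>R z"
proof -
  have "x \<in> cell n z \<longleftrightarrow> (\<forall>b\<in>B. of_int \<lfloor>real n * coord x b\<rfloor> = coord z b)"
    unfolding cell_def
  proof (intro iffI ballI CollectI)
    fix b assume b: "b \<in> B"
    obtain k where k: "coord z b = of_int k" using z b mem_lattice_iff by (blast elim: Ints_cases)
    {
      assume "x \<in> {x. \<forall>b\<in>B. coord x b \<in> {coord z b / real n ..< (coord z b + 1) / real n}}"
      with b have "of_int k \<le> real n * coord x b" "real n * coord x b < of_int k + 1"
        using n k by (auto simp: field_simps)
      then have "\<lfloor>real n * coord x b\<rfloor> = k" by linarith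
      with k show "of_int \<lfloor>real n * coord x b\<rfloor> = coord z b" by simp
    }
    {
      assume "\<forall>b\<in>B. of_int \<lfloor>real n * coord x b\<rfloor> = coord z b"
      with b k have "\<lfloor>real n * coord x b\<rfloor> = k" by (metis of_int_eq_iff)
      then have "of_int k \<le> real n * coord x b" "real n * coord x b < of_int k + 1" by linarith+
      then show "coord x b \<in> {coord z b / real n ..< (coord z b + 1) / real n}"
        using n k by (auto simp: field_simps)
    }
  qed
  also have "\<dots> \<longleftrightarrow> (\<forall>b\<in>B. coord (lattice_floor n x) b = coord ((1 / real n) *\<^sub>R z) b)"
    using n by (simp add: lattice_floor_def coord_comb coord_scale)
  also have "\<dots> \<longleftrightarrow> lattice_floor n x = (1 / real n) *\<^sub>R z"
    using coord_eqI by metis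
  finally show ?thesis .
qed

lemma lattice_floor_mem: "n > 0 \<Longrightarrow> real n *\<^sub>R lattice_floor n x \<in> K"
  by (auto simp: mem_lattice_iff lattice_floor_def coord_scale coord_comb)

lemma sets_cell [measurable]: "cell n z \<in> sets borel"
proof -
  have "cell n z = (\<Inter>b\<in>B. {x. coord z b / real n \<le> coord x b \<and> coord x b < (coord z b + 1) / real n}) \<inter> UNIV"
    by (auto simp: cell_def)
  also have "\<dots> \<in> sets borel"
    by (cases "B = {}") (auto intro!: sets.finite_INT)
  finally show ?thesis .
qed

lemma emeasure_cell:
  assumes "n > 0"
  shows "emeasure leb (cell n z) = ennreal (1 / real n ^ card B)"
proof -
  have "emeasure leb (cell n z)
      = (\<Prod>b\<in>B. emeasure lborel {coord z b / real n ..< (coord z b + 1) / real n})"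
    unfolding cell_def by (rule emeasure_leb_box) simp
  also have "\<dots> = (\<Prod>b\<in>B. ennreal (1 / real n))"
    using assms by (intro prod.cong refl) (simp add: divide_right_mono add_divide_distrib)
  also have "\<dots> = ennreal (1 / real n ^ card B)"
    by (simp add: ennreal_power power_divide)
  finally show ?thesis .
qed

lemma integral_lattice_floor:
  fixes g :: "'k \<Rightarrow> real"
  assumes n: "n > 0" and D: "bounded D" "\<And>x. x \<notin> D \<Longrightarrow> g x = 0"
  defines "Z \<equiv> {z \<in> K. (1 / real n) *\<^sub>R z \<in> D}"
  shows "finite Z"
    and "(\<integral>x. g (lattice_floor n x) \<partial>leb) = (1 / real n ^ card B) * (\<Sum>z\<in>Z. g ((1 / real n) *\<^sub>R z))"
proof -
  obtain C where C: "\<forall>x\<in>D. \<forall>b\<in>B. \<bar>coord x b\<bar> \<le> C"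
    using bounded_coord[OF D(1)] by blast
  have "finite (K \<inter> {z. (1 / real n) *\<^sub>R z \<in> D})"
  proof (rule finite_lattice_points[where C = "real n * C"])
    fix z b assume "z \<in> {z. (1 / real n) *\<^sub>R z \<in> D}" "b \<in> B"
    then have "\<bar>coord ((1 / real n) *\<^sub>R z) b\<bar> \<le> C" using C by blast
    then show "\<bar>coord z b\<bar> \<le> real n * C"
      using n by (simp add: coord_scale abs_mult field_simps)
  qed
  then show Z: "finite Z" by (simp add: Z_def Int_def)
  have eq: "g (lattice_floor n x) = (\<Sum>z\<in>Z. g ((1 / real n) *\<^sub>R z) * indicator (cell n z) x)" for x
  proof -
    define z0 where "z0 = real n *\<^sub>R lattice_floor n x"
    have z0: "(1 / real n) *\<^sub>R z0 = lattice_floor n x" "z0 \<in> K"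
      using n lattice_floor_mem by (auto simp: z0_def)
    have cell: "x \<in> cell n z \<longleftrightarrow> z = z0" if "z \<in> Z" for z
    proof -
      have "x \<in> cell n z \<longleftrightarrow> (1 / real n) *\<^sub>R z0 = (1 / real n) *\<^sub>R z"
        using that n by (simp add: mem_cell_iff z0 Z_def)
      then show ?thesis using n by auto
    qed
    have "(\<Sum>z\<in>Z. g ((1 / real n) *\<^sub>R z) * indicator (cell n z) x)
        = (\<Sum>z\<in>Z. if z = z0 then g ((1 / real n) *\<^sub>R z) else 0)"
      by (rule sum.cong) (auto simp: cell)
    also have "\<dots> = (if z0 \<in> Z then g ((1 / real n) *\<^sub>R z0) else 0)"
      using Z by simp
    also have "\<dots> = g (lattice_floor n x)"
      using z0 D(2) by (auto simp: Z_def)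
    finally show ?thesis by simp
  qed
  have int: "integrable leb (\<lambda>x. g ((1 / real n) *\<^sub>R z) * indicator (cell n z) x)" for z
    using n by (intro integrable_mult_right integrable_real_indicator) (auto simp: emeasure_cell)
  have "(\<integral>x. g (lattice_floor n x) \<partial>leb)
      = (\<Sum>z\<in>Z. \<integral>x. g ((1 / real n) *\<^sub>R z) * indicator (cell n z) x \<partial>leb)"
    unfolding eq using int by (rule Bochner_Integration.integral_sum)
  also have "\<dots> = (\<Sum>z\<in>Z. g ((1 / real n) *\<^sub>R z) * (1 / real n ^ card B))"
    using n by (intro sum.cong refl) (simp add: measure_def emeasure_cell)
  finally show "(\<integral>x. g (lattice_floor n x) \<partial>leb) = (1 / real n ^ card B) * (\<Sum>z\<in>Z. g ((1 / real n) *\<^sub>R z))"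
    by (simp add: sum_distrib_left mult.commute)
qed

lemma riemann_sums_tendsto:
  fixes g :: "'k \<Rightarrow> real"
  assumes g: "g \<in> borel_measurable borel" "\<And>x. \<bar>g x\<bar> \<le> M"
    and D: "bounded D" "\<And>x. x \<notin> D \<Longrightarrow> g x = 0"
    and cont: "AE x in leb. isCont g x"
  shows "(\<lambda>n. (1 / real n ^ card B) * (\<Sum>z\<in>{z \<in> K. (1 / real n) *\<^sub>R z \<in> D}. g ((1 / real n) *\<^sub>R z)))
           \<longlonglongrightarrow> (\<integral>x. g x \<partial>leb)"
proof -
  obtain C where C: "\<forall>x\<in>D. \<forall>b\<in>B. \<bar>coord x b\<bar> \<le> C"
    using bounded_coord[OF D(1)] by blast
  define box where "box = {x. \<forall>b\<in>B. coord x b \<in> {- (C + 1)..C + 1}}"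
  have "box = (\<Inter>b\<in>B. {x. - (C + 1) \<le> coord x b \<and> coord x b \<le> C + 1}) \<inter> UNIV"
    by (auto simp: box_def)
  also have "\<dots> \<in> sets borel"
    by (cases "B = {}") (auto intro!: sets.finite_INT)
  finally have box: "box \<in> sets borel" .
  have "emeasure leb box = (\<Prod>b\<in>B. emeasure lborel {- (C + 1)..C + 1})"
    unfolding box_def by (rule emeasure_leb_box) simp
  also have "\<dots> < \<infinity>" by (cases "- (C + 1) \<le> C + 1") (auto simp: ennreal_power[symmetric] power_less_top_ennreal)
  finally have box_fin: "emeasure leb box < \<infinity>" .
  note [measurable] = g(1)
  have "(\<lambda>n. \<integral>x. g (lattice_floor (Suc n) x) \<partial>leb) \<longlonglongrightarrow> (\<integral>x. g x \<partial>leb)"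
  proof (rule integral_dominated_convergence[where w = "\<lambda>x. M * indicator box x"])
    show "integrable leb (\<lambda>x. M * indicator box x)"
      using box box_fin by (intro integrable_mult_right integrable_real_indicator) auto
    show "AE x in leb. (\<lambda>n. g (lattice_floor (Suc n) x)) \<longlonglongrightarrow> g x"
      using cont by eventually_elim (rule isCont_tendsto_compose[OF _ tendsto_lattice_floor])
    show "AE x in leb. norm (g (lattice_floor (Suc n) x)) \<le> M * indicator box x" for n
    proof (rule AE_I2)
      fix x
      show "norm (g (lattice_floor (Suc n) x)) \<le> M * indicator box x"
      proof (cases "lattice_floor (Suc n) x \<in> D")
        case True
        have "x \<in> box"
          unfolding box_def
        proof (intro CollectI ballI)
          fix b assume b: "b \<in> B"
          let ?m = "real (Suc n)" and ?c = "coord x b"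
          have "\<bar>of_int \<lfloor>?m * ?c\<rfloor> / ?m\<bar> \<le> C"
            using C True b by (auto simp add: lattice_floor_def coord_comb)
          moreover have "of_int \<lfloor>?m * ?c\<rfloor> / ?m \<le> ?c"
            using of_int_floor_le[of "?m * ?c"] by (subst pos_divide_le_eq) (simp_all only: mult.commute of_nat_0_less_iff zero_less_Suc)
          moreover have "?c \<le> of_int \<lfloor>?m * ?c\<rfloor> / ?m + 1"
          proof -
            have "?m * ?c \<le> of_int \<lfloor>?m * ?c\<rfloor> + 1" by linarith
            also have "\<dots> \<le> of_int \<lfloor>?m * ?c\<rfloor> + ?m" by simp
            finally have "?c * ?m \<le> of_int \<lfloor>?m * ?c\<rfloor> + ?m" by (simp only: mult.commute)
            then have "?c \<le> (of_int \<lfloor>?m * ?c\<rfloor> + ?m) / ?m"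
              by (subst pos_le_divide_eq) simp_all
            then show ?thesis by (simp only: add_divide_distrib) simp
          qed
          ultimately show "?c \<in> {- (C + 1)..C + 1}"
            unfolding atLeastAtMost_iff by linarith
        qed
        then show ?thesis using g(2) by simp
      next
        case False
        moreover have "M \<ge> 0" using g(2)[of 0] by linarith
        ultimately show ?thesis using D(2) by simp
      qed
    qed
  qed measurable
  then have "(\<lambda>n. (1 / real (Suc n) ^ card B) *
      (\<Sum>z\<in>{z \<in> K. (1 / real (Suc n)) *\<^sub>R z \<in> D}. g ((1 / real (Suc n)) *\<^sub>R z)))
           \<longlonglongrightarrow> (\<integral>x. g x \<partial>leb)"
    by (subst (asm) integral_lattice_floor(2)[where D = D]) (use D in auto)
  then show ?thesis by (rule LIMSEQ_imp_Suc)
qed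

lemma AE_not_frontier_halfspaces:
  assumes S: "finite S" "\<And>a h. (a, h) \<in> S \<Longrightarrow> linear (a :: 'k \<Rightarrow> real)"
  shows "AE x in leb. x \<notin> frontier {x. \<forall>(a, h)\<in>S. a x \<le> h}"
proof -
  have "{x. \<forall>(a, h)\<in>S. a x \<le> h} = (\<Inter>z\<in>S. {x. fst z x \<le> snd z})" by force
  also have "closed \<dots>"
    using S(2) by (intro closed_INT ballI closed_Collect_le continuous_on_linear continuous_on_const) auto
  finally have closed: "closed {x. \<forall>(a, h)\<in>S. a x \<le> h}" .
  have "AE x in leb. \<forall>z\<in>S. (\<exists>y. fst z y \<noteq> 0) \<longrightarrow> fst z x \<noteq> snd z"
  proof (rule AE_finite_allI[OF S(1)])
    fix z assume z: "z \<in> S"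
    show "AE x in leb. (\<exists>y. fst z y \<noteq> 0) \<longrightarrow> fst z x \<noteq> snd z"
    proof (cases "\<exists>y. fst z y \<noteq> 0")
      case True
      then obtain y where "fst z y \<noteq> 0" by blast
      then have "{x. fst z x = snd z} \<in> null_sets leb"
        using null_sets_hyperplane[OF S(2)] z by (metis prod.collapse)
      from AE_not_in[OF this] show ?thesis by auto
    qed simp
  qed
  then show ?thesis
  proof eventually_elim
    case (elim x)
    show ?case
    proof
      assume fr: "x \<in> frontier {x. \<forall>(a, h)\<in>S. a x \<le> h}"
      then have x: "\<And>z. z \<in> S \<Longrightarrow> fst z x \<le> snd z"
        using closed by (auto simp: frontier_def)
      let ?U = "{y. \<forall>z\<in>{z\<in>S. \<exists>y. fst z y \<noteq> 0}. fst z y < snd z}"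
      have "?U = (\<Inter>z\<in>{z\<in>S. \<exists>y. fst z y \<noteq> 0}. {y. fst z y < snd z})"
        by (rule set_eqI) (simp only: mem_Collect_eq INT_iff)
      also have "open \<dots>"
        using S by (intro open_INT ballI open_Collect_less continuous_on_linear continuous_on_const) auto
      finally have "open ?U" .
      moreover have "x \<in> ?U" using x elim by (auto simp: less_le)
      moreover have "?U \<subseteq> {x. \<forall>(a, h)\<in>S. a x \<le> h}"
      proof
        fix y assume y: "y \<in> ?U"
        have "fst z y \<le> snd z" if "z \<in> S" for z
        proof (cases "\<exists>y. fst z y \<noteq> 0")
          case True
          then have "fst z y < snd z" using y that by blast
          then show ?thesis by simp
        next
          case False
          then show ?thesis using x[OF that] by auto
        qed
        then show "y \<in> {x. \<forall>(a, h)\<in>S. a x \<le> h}" by auto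
      qed
      ultimately have "x \<in> interior {x. \<forall>(a, h)\<in>S. a x \<le> h}" by (rule interiorI)
      then show False using fr by (simp add: frontier_def)
    qed
  qed
qed

end

lemma chop_slice_halfspaces:
  fixes K :: "'k::real_normed_vector set"
  assumes K: "free_ab_group K" and Tp: "free_ab_monoid Tp" and Rp: "free_ab_monoid Rp"
  shows "\<exists>S. finite S \<and> (\<forall>(a, h)\<in>S. linear (a :: 'k \<Rightarrow> real)) \<and>
    chop_slice K Tp Rp p r s l = {x. \<forall>(a, h)\<in>S. a x \<le> h}"
proof -
  define BT where "BT = monoid_basis Tp"
  define BR where "BR = monoid_basis Rp"
  have BT: "vector_basis BT" and BR: "vector_basis BR"
    using monoid_basis[OF Tp] monoid_basis[OF Rp] by (auto simp: BT_def BR_def)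
  let ?S = "(\<lambda>b. (\<lambda>x. - representation BR (real_ext K r x) b, 0)) ` BR
    \<union> (\<lambda>b. (\<lambda>x. representation BT (real_ext K p x) b, representation BT (s l) b)) ` BT"
  have "finite ?S" using BT BR by (simp add: vector_basis_def)
  have pos: "linear (\<lambda>x. representation BT (real_ext K p x) b)" for b
    using linear_compose[OF linear_real_ext[OF K] linear_representation[OF BT]] by (simp add: o_def)
  have neg: "linear (\<lambda>x. - representation BR (real_ext K r x) b)" for b
    using linear_compose[OF linear_real_ext[OF K] linear_representation[OF BR]]
    by (intro linear_compose_neg) (simp add: o_def)
  have "\<forall>(a, h)\<in>?S. linear a" using pos neg by auto
  moreover have "chop_slice K Tp Rp p r s l = {x. \<forall>(a, h)\<in>?S. a x \<le> h}"
    by (simp add: chop_slice_def monoid_le_def BT_def[symmetric] BR_def[symmetric]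
        real_vector.representation_zero ball_Un)
  ultimately show ?thesis using \<open>finite ?S\<close> by (intro exI[of _ ?S]) simp
qed

lemma closed_chop_slice:
  fixes K :: "'k::{real_normed_vector,second_countable_topology} set"
  assumes K: "free_ab_group K" and Tp: "free_ab_monoid Tp" and Rp: "free_ab_monoid Rp"
  shows "closed (chop_slice K Tp Rp p r s l)"
proof -
  interpret real_lattice K by unfold_locales (rule K)
  obtain S where S: "finite S" "\<forall>(a, h)\<in>S. linear (a :: 'k \<Rightarrow> real)"
    "chop_slice K Tp Rp p r s l = {x. \<forall>(a, h)\<in>S. a x \<le> h}"
    using chop_slice_halfspaces[OF assms, where p = p and r = r and s = s and l = l] by blast
  have "chop_slice K Tp Rp p r s l = (\<Inter>z\<in>S. {x. fst z x \<le> snd z})"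
    unfolding S(3) by force
  also have "closed \<dots>"
    using S(2) by (intro closed_INT ballI closed_Collect_le continuous_on_linear continuous_on_const) auto
  finally show ?thesis .
qed

lemma int_span_scale_nat:
  assumes "x \<in> int_span B"
  shows "real n *\<^sub>R x \<in> int_span B"
proof -
  obtain c :: "'a \<Rightarrow> int" where "x = (\<Sum>b\<in>B. of_int (c b) *\<^sub>R b)"
    using assms by (auto simp: int_span_def)
  then have "real n *\<^sub>R x = (\<Sum>b\<in>B. of_int (int n * c b) *\<^sub>R b)"
    by (simp add: scaleR_sum_right)
  then show ?thesis unfolding int_span_def by (intro CollectI exI)
qed

lemma chop_slice_scale:
  assumes K: "free_ab_group K" and L: "free_ab_group L" and Tp: "free_ab_monoid Tp" and Rp: "free_ab_monoid Rp"
    and s: "group_hom_on L H s" and l: "l \<in> L" and n: "n > 0"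
  shows "x \<in> chop_slice K Tp Rp p r s (real n *\<^sub>R l) \<longleftrightarrow> (1 / real n) *\<^sub>R x \<in> chop_slice K Tp Rp p r s l"
proof -
  have nl: "real n *\<^sub>R l \<in> L"
    using int_span_scale_nat[of l "group_basis L" n] l group_basis(2)[OF L] by simp
  have snl: "s (real n *\<^sub>R l) = real n *\<^sub>R s l"
    using real_ext_eq[OF L s nl] real_ext_eq[OF L s l] linear_scale[OF linear_real_ext[OF L]] by metis
  have BT: "vector_basis (monoid_basis Tp)" and BR: "vector_basis (monoid_basis Rp)"
    using monoid_basis Tp Rp by auto
  show ?thesis
    using n unfolding chop_slice_def monoid_le_def snl
    by (simp add: linear_scale[OF linear_real_ext[OF K]] vector_basis_representation_scale[OF BT]
        vector_basis_representation_scale[OF BR] real_vector.representation_zero field_simps)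
qed

lemma integral_scale_measure:
  fixes f :: "'a \<Rightarrow> real"
  assumes f: "f \<in> borel_measurable M" and c: "c \<ge> 0"
  shows "integral\<^sup>L (scale_measure (ennreal c) M) f = c * integral\<^sup>L M f"
proof -
  have "scale_measure (ennreal c) M = density M (\<lambda>_. ennreal c)"
    by (rule measure_eqI) (auto simp: emeasure_density nn_integral_cmult_indicator)
  then show ?thesis using f c by (simp add: integral_density)
qed

lemma integral_mu_scaled:
  fixes f :: "'q::{real_normed_vector,second_countable_topology} \<Rightarrow> real"
    and K :: "'k::{real_normed_vector,second_countable_topology} set"
  assumes K: "free_ab_group K" and f: "f \<in> borel_measurable borel"
    and fin: "finite (chop_slice K Tp Rp p r s (real n *\<^sub>R l) \<inter> K)"
  shows "integral\<^sup>L (mu_scaled K Tp Rp p q r s l n) f =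
    (1 / real n ^ group_rank K) *
      (\<Sum>z\<in>chop_slice K Tp Rp p r s (real n *\<^sub>R l) \<inter> K. f (real_ext K q ((1 / real n) *\<^sub>R z)))"
proof -
  interpret real_lattice K by unfold_locales (rule K)
  let ?A = "chop_slice K Tp Rp p r s (real n *\<^sub>R l) \<inter> K"
  have q: "linear (real_ext K q)" by (rule linear_real_ext[OF K])
  note [measurable] = f borel_measurable_linear[OF q]
  have "integral\<^sup>L (mu_scaled K Tp Rp p q r s l n) f
      = (1 / real n ^ group_rank K) *
        integral\<^sup>L (distr (mu K Tp Rp p q r s (real n *\<^sub>R l)) borel (\<lambda>x. (1 / real n) *\<^sub>R x)) f"
    unfolding mu_scaled_def by (rule integral_scale_measure) simp_all
  also have "integral\<^sup>L (distr (mu K Tp Rp p q r s (real n *\<^sub>R l)) borel (\<lambda>x. (1 / real n) *\<^sub>R x)) f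
      = (\<integral>y. f ((1 / real n) *\<^sub>R y) \<partial>mu K Tp Rp p q r s (real n *\<^sub>R l))"
    by (rule integral_distr) (simp_all add: mu_def)
  also have "\<dots> = (\<integral>x. f ((1 / real n) *\<^sub>R real_ext K q x) \<partial>counting_measure ?A)"
    unfolding mu_def by (rule integral_distr) (simp_all add: counting_measure_def)
  also have "\<dots> = (\<integral>x. f ((1 / real n) *\<^sub>R real_ext K q x) \<partial>count_space ?A)"
    unfolding counting_measure_def by (rule integral_distr) simp_all
  also have "\<dots> = (\<Sum>z\<in>?A. f (real_ext K q ((1 / real n) *\<^sub>R z)))"
    using fin by (simp add: lebesgue_integral_count_space_finite linear_scale[OF q])
  finally show ?thesis .
qed

theorem theorem1:
  fixes K :: "'k::{real_normed_vector,second_countable_topology} set"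
    and L :: "'l::real_vector set"
    and Q :: "'q::{real_normed_vector,second_countable_topology} set"
    and Tp :: "'t::real_vector set"
    and Rp :: "'r::real_vector set"
    and p :: "'k \<Rightarrow> 't" and q :: "'k \<Rightarrow> 'q" and r :: "'k \<Rightarrow> 'r" and s :: "'l \<Rightarrow> 't"
    and l :: 'l
  assumes "chopped_sliced_cone K L Q Tp Rp p q r s"
    and "surj (real_ext K q)"
    and "l \<in> L"
  shows "converges_weakly (mu_scaled K Tp Rp p q r s l) (mu_limit K Tp Rp p q r s l) \<and>
         absolutely_continuous (lattice_lebesgue Q) (mu_limit K Tp Rp p q r s l)"
proof -
  define C where "C = chop_slice K Tp Rp p r s l"
  from assms(1) have K: "free_ab_group K" and L: "free_ab_group L" and Q: "free_ab_group Q"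
    and Tp: "free_ab_monoid Tp" and Rp: "free_ab_monoid Rp"
    and s: "group_hom_on L (monoid_group Tp) s" and bdd: "bounded C"
    using assms(3) by (auto simp: chopped_sliced_cone_def C_def)
  interpret K: real_lattice K by unfold_locales (rule K)
  interpret Q: real_lattice Q by unfold_locales (rule Q)
  have q: "linear (real_ext K q)" by (rule linear_real_ext[OF K])
  have qmeas [measurable]: "real_ext K q \<in> borel_measurable borel"
    by (rule K.borel_measurable_linear[OF q])
  have Cmeas [measurable]: "C \<in> sets borel"
    unfolding C_def by (intro borel_closed closed_chop_slice K Tp Rp)
  obtain S where S: "finite S" "\<forall>(a, h)\<in>S. linear (a :: 'k \<Rightarrow> real)"
    "C = {x. \<forall>(a, h)\<in>S. a x \<le> h}"
    unfolding C_def using chop_slice_halfspaces[OF K Tp Rp, where p = p and r = r and s = s and l = l] by blast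
  have C_ae: "AE x in K.leb. x \<notin> frontier C"
    unfolding S(3) by (rule K.AE_not_frontier_halfspaces[OF S(1)]) (use S(2) in auto)
  have "converges_weakly (mu_scaled K Tp Rp p q r s l) (mu_limit K Tp Rp p q r s l)"
    unfolding converges_weakly_def
  proof (intro allI impI)
    fix f :: "'q \<Rightarrow> real"
    assume f: "continuous_on UNIV f \<and> bounded (range f)"
    have fmeas [measurable]: "f \<in> borel_measurable borel"
      using f by (intro borel_measurable_continuous_onI) simp
    obtain M where M: "\<And>x. \<bar>f x\<bar> \<le> M"
      using f by (auto simp: bounded_iff)
    define g where "g x = indicator C x * f (real_ext K q x)" for x
    have "(\<lambda>n. (1 / real n ^ card K.B) * (\<Sum>z\<in>{z \<in> K. (1 / real n) *\<^sub>R z \<in> C}. g ((1 / real n) *\<^sub>R z)))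
        \<longlonglongrightarrow> (\<integral>x. g x \<partial>K.leb)"
    proof (rule K.riemann_sums_tendsto[OF _ _ bdd])
      show "g \<in> borel_measurable borel" unfolding g_def by measurable
      show "\<bar>g x\<bar> \<le> M" for x
        using M[of "real_ext K q x"] by (auto simp: g_def indicator_def)
      show "g x = 0" if "x \<notin> C" for x using that by (simp add: g_def)
      show "AE x in K.leb. isCont g x"
        using C_ae
      proof eventually_elim
        case (elim x)
        have "isCont (real_ext K q) x" "isCont f (real_ext K q x)"
          using f K.continuous_on_linear[OF q, of UNIV]
          by (simp_all add: continuous_on_eq_continuous_at)
        then have "isCont (\<lambda>x. f (real_ext K q x)) x"
          by (rule isCont_o2)
        moreover have "isCont (indicator C :: 'k \<Rightarrow> real) x"
          using elim by (simp add: isCont_indicator)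
        ultimately show ?case
          unfolding g_def by (intro isCont_mult)
      qed
    qed
    also have "(\<integral>x. g x \<partial>K.leb) = integral\<^sup>L (mu_limit K Tp Rp p q r s l) f"
    proof -
      have "integral\<^sup>L (mu_limit K Tp Rp p q r s l) f
          = (\<integral>x. f (real_ext K q x) \<partial>density K.leb (\<lambda>x. ennreal (indicator C x)))"
        unfolding mu_limit_def C_def[symmetric] ennreal_indicator by (rule integral_distr) simp_all
      also have "\<dots> = (\<integral>x. g x \<partial>K.leb)"
        by (subst integral_density) (simp_all add: g_def[abs_def])
      finally show ?thesis ..
    qed
    finally show "(\<lambda>n. integral\<^sup>L (mu_scaled K Tp Rp p q r s l n) f)
        \<longlonglongrightarrow> integral\<^sup>L (mu_limit K Tp Rp p q r s l) f"
    proof (rule Lim_transform_eventually)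
      show "\<forall>\<^sub>F n in sequentially.
          (1 / real n ^ card K.B) * (\<Sum>z\<in>{z \<in> K. (1 / real n) *\<^sub>R z \<in> C}. g ((1 / real n) *\<^sub>R z))
          = integral\<^sup>L (mu_scaled K Tp Rp p q r s l n) f"
        using eventually_gt_at_top[of 0]
      proof eventually_elim
        case (elim n)
        have eq: "chop_slice K Tp Rp p r s (real n *\<^sub>R l) \<inter> K = {z \<in> K. (1 / real n) *\<^sub>R z \<in> C}"
          using chop_slice_scale[OF K L Tp Rp s assms(3) elim] by (auto simp: C_def)
        have fin: "finite {z \<in> K. (1 / real n) *\<^sub>R z \<in> C}"
          using K.integral_lattice_floor(1)[OF elim bdd, of "\<lambda>_. 0"] by simp
        show ?case
          using integral_mu_scaled[OF K fmeas, of Tp Rp p r s n l q] fin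
          unfolding eq by (simp add: group_rank_def g_def)
      qed
    qed
  qed
  moreover have "absolutely_continuous (lattice_lebesgue Q) (mu_limit K Tp Rp p q r s l)"
    unfolding absolutely_continuous_def
  proof
    fix A assume A: "A \<in> null_sets (lattice_lebesgue Q)"
    obtain g where g: "linear g" "real_ext K q \<circ> g = id"
      using linear_surjective_right_inverse[OF q assms(2)] by blast
    have "real_ext K q -` A \<in> null_sets K.leb"
      using g A
      by (intro K.null_sets_vimage_linear[where g = g and N = "lattice_lebesgue Q"] q
            Q.continuous_on_linear Q.sigma_finite_leb Q.sets_leb Q.leb_translation Q.leb_UNIV)
         (auto simp: fun_eq_iff)
    moreover have "absolutely_continuous K.leb (density K.leb (indicator C))"
      by (rule absolutely_continuousI_density) simp
    ultimately have "real_ext K q -` A \<in> null_sets (density K.leb (indicator C))"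
      by (auto simp: absolutely_continuous_def)
    then show "A \<in> null_sets (mu_limit K Tp Rp p q r s l)"
      using A unfolding mu_limit_def C_def[symmetric] by (subst null_sets_distr_iff) auto
  qed
  ultimately show ?thesis ..
qed

end
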